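(* For every nonnegative integer $k$, the additive semigroup $\mathbb{N}+k$ of integers $\geq k$ is prime in the category of cancellative semigroups, and, more generally, in the category of right cancellative semigroups and in the category of left cancellative semigroups, and still more generally, in the category of weakly cancellative semigroups.
   Context: "Semigroup" means nonempty semigroup. $\mathbb{N}$ is the additive semigroup of all nonnegative integers, and $\mathbb{N}+k=\{n\in\mathbb{Z} : n\ge k\}$ under addition. A semigroup $S$ is right cancellative if for all $s\neq s'$ in $S$ and all $s''\in S$ one has $ss''\neq s's''$; left cancellative if for all $s\neq s'$ in $S$ and all $s''\in S$ one has $s''s\neq s''s'$; cancellative if it is both right and left cancellative; and weakly cancellative if for all $s\neq s'$ in $S$ there exists $s''\in S$ such that at least one of $ss''\neq s's''$ or $s''s\neq s''s'$ holds. Each of the categories mentioned is the full subcategory of the category of semigroups on the semigroups with the indicated property. In a category $\mathcal{C}$ with finite direct products, $Y$ admits $X$ as a direct factor if $Y\cong X\times Z$ for some object $Z$ of $\mathcal{C}$. An object $X$ of $\mathcal{C}$ other than the final object (here, the one-element semigroup) is called prime in $\mathcal{C}$ (in the sense of Tarski) if, whenever an object $Y$ of $\mathcal{C}$ admits $X$ as a direct factor, and $Y=Y_0\times Y_1$ is another direct product decomposition of $Y$ in $\mathcal{C}$, then one of $Y_0,Y_1$ admits $X$ as a direct factor. *)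

theory Defs
  imports "HOL-Algebra.Group"
begin

text \<open>
  Semigroups are represented by the record type of HOL-Algebra monoids. The field \<open>one\<close> carries
  no information: nothing below constrains it, and \<^const>\<open>hom\<close>, \<^const>\<open>iso\<close>, \<^const>\<open>is_iso\<close> and the
  carrier and multiplication of \<^const>\<open>DirProd\<close> do not depend on it.
\<close>

definition is_semigroup :: "'a monoid \<Rightarrow> bool" where
  "is_semigroup S \<longleftrightarrow>
     carrier S \<noteq> {} \<and>
     (\<forall>x\<in>carrier S. \<forall>y\<in>carrier S. x \<otimes>\<^bsub>S\<^esub> y \<in> carrier S) \<and>
     (\<forall>x\<in>carrier S. \<forall>y\<in>carrier S. \<forall>z\<in>carrier S.
        (x \<otimes>\<^bsub>S\<^esub> y) \<otimes>\<^bsub>S\<^esub> z = x \<otimes>\<^bsub>S\<^esub> (y \<otimes>\<^bsub>S\<^esub> z))"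

definition right_cancellative :: "'a monoid \<Rightarrow> bool" where
  "right_cancellative S \<longleftrightarrow>
     (\<forall>s\<in>carrier S. \<forall>s'\<in>carrier S. s \<noteq> s' \<longrightarrow>
        (\<forall>t\<in>carrier S. s \<otimes>\<^bsub>S\<^esub> t \<noteq> s' \<otimes>\<^bsub>S\<^esub> t))"

definition left_cancellative :: "'a monoid \<Rightarrow> bool" where
  "left_cancellative S \<longleftrightarrow>
     (\<forall>s\<in>carrier S. \<forall>s'\<in>carrier S. s \<noteq> s' \<longrightarrow>
        (\<forall>t\<in>carrier S. t \<otimes>\<^bsub>S\<^esub> s \<noteq> t \<otimes>\<^bsub>S\<^esub> s'))"

definition cancellative :: "'a monoid \<Rightarrow> bool" where
  "cancellative S \<longleftrightarrow> right_cancellative S \<and> left_cancellative S"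

definition weakly_cancellative :: "'a monoid \<Rightarrow> bool" where
  "weakly_cancellative S \<longleftrightarrow>
     (\<forall>s\<in>carrier S. \<forall>s'\<in>carrier S. s \<noteq> s' \<longrightarrow>
        (\<exists>t\<in>carrier S. s \<otimes>\<^bsub>S\<^esub> t \<noteq> s' \<otimes>\<^bsub>S\<^esub> t \<or> t \<otimes>\<^bsub>S\<^esub> s \<noteq> t \<otimes>\<^bsub>S\<^esub> s'))"

text \<open>
  The full subcategories of the category of semigroups are named by a datatype, because a
  predicate variable on semigroups could not be used at several carrier types at once.
\<close>

datatype semigroup_category =
  Cancellative | Right_Cancellative | Left_Cancellative | Weakly_Cancellative

definition is_object :: "semigroup_category \<Rightarrow> 'a monoid \<Rightarrow> bool" where
  "is_object C S \<longleftrightarrow> is_semigroup S \<and>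
     (case C of
        Cancellative \<Rightarrow> cancellative S
      | Right_Cancellative \<Rightarrow> right_cancellative S
      | Left_Cancellative \<Rightarrow> left_cancellative S
      | Weakly_Cancellative \<Rightarrow> weakly_cancellative S)"

text \<open>
  The complement \<open>Z\<close> is taken with carrier inside the type of \<open>Y\<close>. This loses no generality,
  see \<open>admits_direct_factorI\<close> below.
\<close>

definition admits_direct_factor :: "semigroup_category \<Rightarrow> 'b monoid \<Rightarrow> 'a monoid \<Rightarrow> bool" where
  "admits_direct_factor C Y X \<longleftrightarrow> (\<exists>Z :: 'b monoid. is_object C Z \<and> Y \<cong> X \<times>\<times> Z)"

definition is_one_element :: "'a monoid \<Rightarrow> bool" where
  "is_one_element S \<longleftrightarrow> (\<exists>e. carrier S = {e})"

text \<open>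
  The phantom argument only names the carrier types over which \<open>Y\<close>, \<open>Y\<^sub>0\<close> and \<open>Y\<^sub>1\<close> range. HOL
  cannot quantify over types inside a definition, so primality in the whole category is this
  predicate at type variables \<open>'y\<close>, \<open>'y0\<close>, \<open>'y1\<close> left free in a theorem.
\<close>

definition prime_in ::
  "semigroup_category \<Rightarrow> 'a monoid \<Rightarrow> ('y \<times> 'y0 \<times> 'y1) itself \<Rightarrow> bool" where
  "prime_in C X (_ :: ('y \<times> 'y0 \<times> 'y1) itself) \<longleftrightarrow>
     is_object C X \<and> \<not> is_one_element X \<and>
     (\<forall>(Y :: 'y monoid) (Y\<^sub>0 :: 'y0 monoid) (Y\<^sub>1 :: 'y1 monoid).
        is_object C Y \<longrightarrow> is_object C Y\<^sub>0 \<longrightarrow> is_object C Y\<^sub>1 \<longrightarrow>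
        admits_direct_factor C Y X \<longrightarrow> Y \<cong> Y\<^sub>0 \<times>\<times> Y\<^sub>1 \<longrightarrow>
        admits_direct_factor C Y\<^sub>0 X \<or> admits_direct_factor C Y\<^sub>1 X)"

definition nat_plus :: "nat \<Rightarrow> int monoid" where
  "nat_plus k = \<lparr>carrier = {n. n \<ge> int k}, mult = (+), one = undefined\<rparr>"

lemma is_object_DirProd:
  assumes "is_object C S" "is_object C T"
  shows "is_object C (S \<times>\<times> T)"
proof -
  have sg: "is_semigroup S" "is_semigroup T"
    using assms by (auto simp: is_object_def)
  have "is_semigroup (S \<times>\<times> T)"
    using sg by (auto simp: is_semigroup_def DirProd_def)
  moreover have R: "right_cancellative (S \<times>\<times> T)"
    if "right_cancellative S" "right_cancellative T"
    using that by (auto simp: right_cancellative_def DirProd_def)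
  moreover have L: "left_cancellative (S \<times>\<times> T)"
    if "left_cancellative S" "left_cancellative T"
    using that by (auto simp: left_cancellative_def DirProd_def)
  moreover have "weakly_cancellative (S \<times>\<times> T)"
    if w: "weakly_cancellative S" "weakly_cancellative T"
    unfolding weakly_cancellative_def
  proof (intro ballI impI)
    fix p q assume p: "p \<in> carrier (S \<times>\<times> T)" and q: "q \<in> carrier (S \<times>\<times> T)" and "p \<noteq> q"
    obtain a b where ab: "p = (a, b)" by (cases p)
    obtain c d where cd: "q = (c, d)" by (cases q)
    have mem: "a \<in> carrier S" "c \<in> carrier S" "b \<in> carrier T" "d \<in> carrier T"
      using p q ab cd by (auto simp: DirProd_def)
    obtain u v where uv: "u \<in> carrier S" "v \<in> carrier T"
      using sg by (auto simp: is_semigroup_def)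
    let ?P = "\<lambda>t. p \<otimes>\<^bsub>S \<times>\<times> T\<^esub> t \<noteq> q \<otimes>\<^bsub>S \<times>\<times> T\<^esub> t \<or> t \<otimes>\<^bsub>S \<times>\<times> T\<^esub> p \<noteq> t \<otimes>\<^bsub>S \<times>\<times> T\<^esub> q"
    consider "a \<noteq> c" | "b \<noteq> d" using \<open>p \<noteq> q\<close> ab cd by auto
    then show "\<exists>t\<in>carrier (S \<times>\<times> T). ?P t"
    proof cases
      case 1
      then obtain t where "t \<in> carrier S" "a \<otimes>\<^bsub>S\<^esub> t \<noteq> c \<otimes>\<^bsub>S\<^esub> t \<or> t \<otimes>\<^bsub>S\<^esub> a \<noteq> t \<otimes>\<^bsub>S\<^esub> c"
        using w(1) mem unfolding weakly_cancellative_def by blast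
      then have "(t, v) \<in> carrier (S \<times>\<times> T)" "?P (t, v)"
        using uv ab cd by (auto simp: DirProd_def)
      then show ?thesis by blast
    next
      case 2
      then obtain t where "t \<in> carrier T" "b \<otimes>\<^bsub>T\<^esub> t \<noteq> d \<otimes>\<^bsub>T\<^esub> t \<or> t \<otimes>\<^bsub>T\<^esub> b \<noteq> t \<otimes>\<^bsub>T\<^esub> d"
        using w(2) mem unfolding weakly_cancellative_def by blast
      then have "(u, t) \<in> carrier (S \<times>\<times> T)" "?P (u, t)"
        using uv ab cd by (auto simp: DirProd_def)
      then show ?thesis by blast
    qed
  qed
  ultimately show ?thesis
    using assms by (cases C) (auto simp: is_object_def cancellative_def)
qed

lemma is_object_iso:
  assumes S: "is_object C S" and f: "f \<in> iso S T"
  shows "is_object C T"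
proof -
  have c: "carrier T = f ` carrier S"
    and inj: "inj_on f (carrier S)"
    and h: "\<And>x y. x \<in> carrier S \<Longrightarrow> y \<in> carrier S \<Longrightarrow> f x \<otimes>\<^bsub>T\<^esub> f y = f (x \<otimes>\<^bsub>S\<^esub> y)"
    using f by (auto simp: iso_def hom_def bij_betw_def)
  have sg: "is_semigroup S" using S by (simp add: is_object_def)
  then have cl: "\<And>x y. x \<in> carrier S \<Longrightarrow> y \<in> carrier S \<Longrightarrow> x \<otimes>\<^bsub>S\<^esub> y \<in> carrier S"
    by (auto simp: is_semigroup_def)
  have eq: "f x = f y \<longleftrightarrow> x = y" if "x \<in> carrier S" "y \<in> carrier S" for x y
    using that inj by (auto simp: inj_on_def)
  have "is_semigroup T" 
    using sg by (simp add: is_semigroup_def c h cl)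
  moreover have "right_cancellative T" if "right_cancellative S"
    using that by (simp add: right_cancellative_def c h cl eq)
  moreover have "left_cancellative T" if "left_cancellative S"
    using that by (simp add: left_cancellative_def c h cl eq)
  moreover have "weakly_cancellative T" if "weakly_cancellative S"
    using that by (simp add: weakly_cancellative_def c h cl eq)
  ultimately show ?thesis
    using S by (cases C) (auto simp: is_object_def cancellative_def)
qed

lemma admits_direct_factorI:
  fixes X :: "'a monoid" and Y :: "'b monoid" and Z :: "'c monoid"
  assumes X: "is_object C X" and Z: "is_object C Z" and iso: "Y \<cong> X \<times>\<times> Z"
  shows "admits_direct_factor C Y X"
proof -
  obtain f where f: "f \<in> iso Y (X \<times>\<times> Z)" using iso by (auto simp: is_iso_def)
  obtain x where x: "x \<in> carrier X" using X by (auto simp: is_object_def is_semigroup_def)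
  define g where "g z = inv_into (carrier Y) f (x, z)" for z
  have bij: "bij_betw f (carrier Y) (carrier X \<times> carrier Z)"
    using f by (simp add: iso_def DirProd_def)
  have fg: "f (g z) = (x, z)" if "z \<in> carrier Z" for z
    unfolding g_def using bij x that by (simp add: bij_betw_def f_inv_into_f)
  have inj: "inj_on g (carrier Z)" by (metis (mono_tags, lifting) fg inj_onI prod.inject)
  define i where "i = inv_into (carrier Z) g"
  have ig: "i (g z) = z" if "z \<in> carrier Z" for z
    unfolding i_def using inj that by simp
  define W :: "'b monoid" where
    "W = \<lparr>carrier = g ` carrier Z, mult = (\<lambda>a b. g (i a \<otimes>\<^bsub>Z\<^esub> i b)), one = undefined\<rparr>"
  have clZ: "\<And>a b. a \<in> carrier Z \<Longrightarrow> b \<in> carrier Z \<Longrightarrow> a \<otimes>\<^bsub>Z\<^esub> b \<in> carrier Z"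
    using Z by (auto simp: is_object_def is_semigroup_def)
  have "g \<in> iso Z W"
    using inj by (auto simp: iso_def hom_def bij_betw_def W_def ig)
  then have W: "is_object C W" using Z is_object_iso by blast
  define p where "p = (\<lambda>(a :: 'a, z). (a, g z))"
  have "p \<in> iso (X \<times>\<times> Z) (X \<times>\<times> W)"
    using inj by (auto simp: iso_def hom_def bij_betw_def W_def ig p_def DirProd_def inj_on_def
        image_iff)
  then have "Y \<cong> X \<times>\<times> W"
    using iso_set_trans[OF f] by (auto simp: is_iso_def)
  then show ?thesis using W by (auto simp: admits_direct_factor_def)
qed

end

theory Submission
  imports Defs
begin

text \<open>
  A direct factor \<open>\<nat> + k\<close> of a semigroup \<open>S \<cong> (\<nat> + k) \<times> Z\<close> leaves two traces on \<open>S\<close>: the shift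
  \<open>\<sigma>(n, z) = (n + 1, z)\<close>, which satisfies \<open>\<sigma>(x) y = \<sigma>(x y) = x \<sigma>(y)\<close>, and the level \<open>l(n, z) = n - k\<close>.
  Conversely these two maps determine the factor: \<open>Z\<close> is recovered as the set of elements of level
  \<open>0\<close>, and an element of level \<open>n\<close> is the \<open>n\<close>-fold shift of a unique element of level \<open>0\<close>
  (\<open>admits_direct_factor_imp_level_shift\<close>, \<open>level_shift_imp_admits_direct_factor\<close>). So it suffices to
  move such a pair of maps from \<open>A \<times> B\<close> to \<open>A\<close> or to \<open>B\<close>.

  Weak cancellation forces every map commuting with multiplication in this way to act
  coordinatewise, \<open>\<sigma> = \<alpha> \<times> \<beta>\<close> (\<open>central_shift_DirProd_splits\<close>). If \<open>a\<close> were outside the image of \<open>\<alpha>\<close>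
  and \<open>b\<close> outside the image of \<open>\<beta>\<close>, then \<open>(a, y)\<close> and \<open>(x, b)\<close> would have level \<open>0\<close> for all \<open>x\<close> and
  \<open>y\<close>, so their product \<open>(a x, y b)\<close> would have level \<open>k\<close>. But replacing \<open>(x, y)\<close> by
  \<open>(\<alpha> x, \<beta> y)\<close> applies \<open>\<sigma>\<close> to that product and must raise its level. Hence one of the two maps, say
  \<open>\<beta>\<close>, is surjective (\<open>level_shift_surj\<close>). Then the level of \<open>(a, b)\<close>, which counts how often \<open>\<sigma>\<close>
  can be undone, depends on \<open>a\<close> only, and together with \<open>\<alpha>\<close> it exhibits \<open>\<nat> + k\<close> as a factor of \<open>A\<close>
  (\<open>level_shift_fst\<close>).
\<close>

section \<open>Shifts that commute with multiplication\<close>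

definition central_shift :: "'a monoid \<Rightarrow> ('a \<Rightarrow> 'a) \<Rightarrow> bool" where
  "central_shift S \<sigma> \<longleftrightarrow>
     (\<forall>x\<in>carrier S. \<sigma> x \<in> carrier S) \<and>
     (\<forall>x\<in>carrier S. \<forall>y\<in>carrier S.
        \<sigma> x \<otimes>\<^bsub>S\<^esub> y = \<sigma> (x \<otimes>\<^bsub>S\<^esub> y) \<and> x \<otimes>\<^bsub>S\<^esub> \<sigma> y = \<sigma> (x \<otimes>\<^bsub>S\<^esub> y))"

text \<open>
  The products of \<open>fst (\<sigma> (a, b))\<close> with an element \<open>t\<close>, on either side, can be rewritten by moving \<open>\<sigma>\<close>
  to the other factor; then \<open>b\<close> no longer occurs in them. Weak cancellation is exactly the statement
  that an element is determined by these products.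
\<close>

lemma central_shift_DirProd_fst:
  assumes A: "weakly_cancellative A"
    and \<sigma>: "central_shift (A \<times>\<times> B) \<sigma>"
    and a: "a \<in> carrier A" and b: "b \<in> carrier B" "b' \<in> carrier B"
  shows "fst (\<sigma> (a, b)) = fst (\<sigma> (a, b'))"
proof (rule ccontr)
  have into: "fst (\<sigma> (u, v)) \<in> carrier A" if "u \<in> carrier A" "v \<in> carrier B" for u v
    using \<sigma> that by (auto simp: central_shift_def DirProd_def mem_Times_iff)
  have eq: "fst (\<sigma> (u, v)) \<otimes>\<^bsub>A\<^esub> u' = u \<otimes>\<^bsub>A\<^esub> fst (\<sigma> (u', v'))"
    if "u \<in> carrier A" "v \<in> carrier B" "u' \<in> carrier A" "v' \<in> carrier B" for u v u' v'
  proof -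
    have "\<sigma> (u, v) \<otimes>\<^bsub>A \<times>\<times> B\<^esub> (u', v') = (u, v) \<otimes>\<^bsub>A \<times>\<times> B\<^esub> \<sigma> (u', v')"
      using \<sigma> that by (simp add: central_shift_def DirProd_def)
    then show ?thesis
      by (cases "\<sigma> (u, v)"; cases "\<sigma> (u', v')") (simp add: DirProd_def)
  qed
  assume "fst (\<sigma> (a, b)) \<noteq> fst (\<sigma> (a, b'))"
  then obtain t where t: "t \<in> carrier A"
    and "fst (\<sigma> (a, b)) \<otimes>\<^bsub>A\<^esub> t \<noteq> fst (\<sigma> (a, b')) \<otimes>\<^bsub>A\<^esub> t \<or>
         t \<otimes>\<^bsub>A\<^esub> fst (\<sigma> (a, b)) \<noteq> t \<otimes>\<^bsub>A\<^esub> fst (\<sigma> (a, b'))"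
    using A into a b unfolding weakly_cancellative_def by meson
  then show False
    using eq[OF a b(1) t b(1)] eq[OF a b(2) t b(1)] eq[OF t b(1) a b(1)] eq[OF t b(1) a b(2)]
    by metis
qed

lemma central_shift_DirProd_swap:
  assumes "central_shift (A \<times>\<times> B) \<sigma>"
  shows "central_shift (B \<times>\<times> A) (prod.swap \<circ> \<sigma> \<circ> prod.swap)"
proof -
  have mult: "x \<otimes>\<^bsub>B \<times>\<times> A\<^esub> y = prod.swap (prod.swap x \<otimes>\<^bsub>A \<times>\<times> B\<^esub> prod.swap y)" for x y
    by (cases x; cases y) simp
  have carr: "x \<in> carrier (B \<times>\<times> A) \<longleftrightarrow> prod.swap x \<in> carrier (A \<times>\<times> B)" for x
    by (cases x) auto
  show ?thesis
    using assms by (auto simp: central_shift_def mult carr mem_Times_iff)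
qed

lemma central_shift_DirProd_snd:
  assumes B: "weakly_cancellative B"
    and \<sigma>: "central_shift (A \<times>\<times> B) \<sigma>"
    and a: "a \<in> carrier A" "a' \<in> carrier A" and b: "b \<in> carrier B"
  shows "snd (\<sigma> (a, b)) = snd (\<sigma> (a', b))"
  using central_shift_DirProd_fst[OF B central_shift_DirProd_swap[OF \<sigma>] b a] by simp

lemma central_shift_DirProd_splits:
  assumes A: "is_object Weakly_Cancellative A" and B: "is_object Weakly_Cancellative B"
    and \<sigma>: "central_shift (A \<times>\<times> B) \<sigma>"
  obtains \<alpha> \<beta> where "central_shift A \<alpha>" "central_shift B \<beta>"
    "\<And>a b. a \<in> carrier A \<Longrightarrow> b \<in> carrier B \<Longrightarrow> \<sigma> (a, b) = (\<alpha> a, \<beta> b)"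
proof -
  obtain a0 b0 where ab0: "a0 \<in> carrier A" "b0 \<in> carrier B"
    using A B by (auto simp: is_object_def is_semigroup_def)
  have cl: "\<And>x y. x \<in> carrier A \<Longrightarrow> y \<in> carrier A \<Longrightarrow> x \<otimes>\<^bsub>A\<^esub> y \<in> carrier A"
      "\<And>x y. x \<in> carrier B \<Longrightarrow> y \<in> carrier B \<Longrightarrow> x \<otimes>\<^bsub>B\<^esub> y \<in> carrier B"
    using A B by (auto simp: is_object_def is_semigroup_def)
  define \<alpha> where "\<alpha> a = fst (\<sigma> (a, b0))" for a
  define \<beta> where "\<beta> b = snd (\<sigma> (a0, b))" for b
  have split: "\<sigma> (a, b) = (\<alpha> a, \<beta> b)" if "a \<in> carrier A" "b \<in> carrier B" for a b
    using central_shift_DirProd_fst[OF _ \<sigma> that(1) that(2) ab0(2)]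
      central_shift_DirProd_snd[OF _ \<sigma> that(1) ab0(1) that(2)] A B
    by (simp add: is_object_def \<alpha>_def \<beta>_def prod_eq_iff)
  have into: "\<alpha> a \<in> carrier A \<and> \<beta> b \<in> carrier B" if "a \<in> carrier A" "b \<in> carrier B" for a b
  proof -
    have "\<sigma> (a, b) \<in> carrier (A \<times>\<times> B)" using \<sigma> that by (simp add: central_shift_def)
    then show ?thesis using split[OF that] by simp
  qed
  have prods: "(\<alpha> a \<otimes>\<^bsub>A\<^esub> a', \<beta> b \<otimes>\<^bsub>B\<^esub> b') = (\<alpha> (a \<otimes>\<^bsub>A\<^esub> a'), \<beta> (b \<otimes>\<^bsub>B\<^esub> b')) \<and>
      (a \<otimes>\<^bsub>A\<^esub> \<alpha> a', b \<otimes>\<^bsub>B\<^esub> \<beta> b') = (\<alpha> (a \<otimes>\<^bsub>A\<^esub> a'), \<beta> (b \<otimes>\<^bsub>B\<^esub> b'))"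
    if "a \<in> carrier A" "a' \<in> carrier A" "b \<in> carrier B" "b' \<in> carrier B" for a a' b b'
  proof -
    have "\<sigma> (a, b) \<otimes>\<^bsub>A \<times>\<times> B\<^esub> (a', b') = \<sigma> (a \<otimes>\<^bsub>A\<^esub> a', b \<otimes>\<^bsub>B\<^esub> b') \<and>
        (a, b) \<otimes>\<^bsub>A \<times>\<times> B\<^esub> \<sigma> (a', b') = \<sigma> (a \<otimes>\<^bsub>A\<^esub> a', b \<otimes>\<^bsub>B\<^esub> b')"
      using \<sigma> that by (simp add: central_shift_def DirProd_def)
    then show ?thesis using that by (simp add: split cl DirProd_def)
  qed
  have "central_shift A \<alpha>"
    unfolding central_shift_def using into prods ab0 by blast
  moreover have "central_shift B \<beta>"
    unfolding central_shift_def using into prods ab0 by blast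
  ultimately show ?thesis using split that by blast
qed

section \<open>Direct factors of the form \<open>\<nat> + k\<close>\<close>

text \<open>
  The level \<open>l\<close> counts upwards from \<open>0\<close>, so it is the coordinate in \<open>\<nat> + k\<close> lowered by \<open>k\<close>; this is
  the origin of the summand \<open>k\<close> in the rule for products.
\<close>

definition level_shift :: "nat \<Rightarrow> 'a monoid \<Rightarrow> ('a \<Rightarrow> nat) \<Rightarrow> ('a \<Rightarrow> 'a) \<Rightarrow> bool" where
  "level_shift k S l \<sigma> \<longleftrightarrow>
     central_shift S \<sigma> \<and> inj_on \<sigma> (carrier S) \<and>
     (\<forall>x\<in>carrier S. \<forall>y\<in>carrier S. l (x \<otimes>\<^bsub>S\<^esub> y) = l x + l y + k) \<and>
     (\<forall>x\<in>carrier S. l (\<sigma> x) = Suc (l x)) \<and>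
     (\<forall>x\<in>carrier S. l x > 0 \<longrightarrow> x \<in> \<sigma> ` carrier S)"

lemma level_shift_DirProd_swap:
  assumes "level_shift k (A \<times>\<times> B) l \<sigma>"
  shows "level_shift k (B \<times>\<times> A) (l \<circ> prod.swap) (prod.swap \<circ> \<sigma> \<circ> prod.swap)"
proof -
  have mult: "prod.swap (x \<otimes>\<^bsub>B \<times>\<times> A\<^esub> y) = prod.swap x \<otimes>\<^bsub>A \<times>\<times> B\<^esub> prod.swap y" for x y
    by (cases x; cases y) simp
  have carr: "carrier (B \<times>\<times> A) = prod.swap ` carrier (A \<times>\<times> B)"
    by (simp add: product_swap)
  show ?thesis
    using assms central_shift_DirProd_swap[of A B \<sigma>]
    by (auto simp: level_shift_def mult carr inj_on_def image_image inj_eq[OF inj_swap]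
        simp del: carrier_DirProd)
qed

lemma admits_direct_factor_imp_level_shift:
  assumes S: "is_semigroup S" and "admits_direct_factor C S (nat_plus k)"
  obtains l \<sigma> where "level_shift k S l \<sigma>"
proof -
  obtain Z :: "'a monoid" and f where f: "f \<in> iso S (nat_plus k \<times>\<times> Z)"
    using assms(2) by (auto simp: admits_direct_factor_def is_iso_def)
  have bij: "bij_betw f (carrier S) ({int k..} \<times> carrier Z)"
    using f by (simp add: iso_def nat_plus_def atLeast_def)
  have hom: "f (x \<otimes>\<^bsub>S\<^esub> y) = (fst (f x) + fst (f y), snd (f x) \<otimes>\<^bsub>Z\<^esub> snd (f y))"
    if "x \<in> carrier S" "y \<in> carrier S" for x y
    using f that by (cases "f x"; cases "f y") (simp add: iso_def hom_def nat_plus_def)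
  have cl: "x \<otimes>\<^bsub>S\<^esub> y \<in> carrier S" if "x \<in> carrier S" "y \<in> carrier S" for x y
    using S that by (simp add: is_semigroup_def)
  have range: "fst (f x) \<ge> int k \<and> snd (f x) \<in> carrier Z" if "x \<in> carrier S" for x
    using bij_betwE[OF bij] that by (auto simp: mem_Times_iff)
  have eqI: "x = y" if "f x = f y" "x \<in> carrier S" "y \<in> carrier S" for x y
    using bij that by (auto simp: bij_betw_def inj_on_def)
  define g where "g = inv_into (carrier S) f"
  have g: "g (n, z) \<in> carrier S" "f (g (n, z)) = (n, z)" if "n \<ge> int k" "z \<in> carrier Z" for n z
    using bij that by (auto simp: g_def bij_betw_def inv_into_into f_inv_into_f)
  define l where "l x = nat (fst (f x) - int k)" for x
  define \<sigma> where "\<sigma> x = g (fst (f x) + 1, snd (f x))" for x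
  have \<sigma>: "\<sigma> x \<in> carrier S" "f (\<sigma> x) = (fst (f x) + 1, snd (f x))" if "x \<in> carrier S" for x
    using g range[OF that] by (auto simp: \<sigma>_def)
  have "central_shift S \<sigma>"
    unfolding central_shift_def by (intro conjI ballI eqI) (simp_all add: \<sigma> hom cl)
  moreover have "inj_on \<sigma> (carrier S)"
  proof (rule inj_onI)
    fix x y assume xy: "x \<in> carrier S" "y \<in> carrier S" "\<sigma> x = \<sigma> y"
    then have "(fst (f x) + 1, snd (f x)) = (fst (f y) + 1, snd (f y))" using \<sigma>(2) by metis
    with xy show "x = y" by (intro eqI) (simp_all add: prod_eq_iff)
  qed
  moreover have "x \<in> \<sigma> ` carrier S" if "x \<in> carrier S" "l x > 0" for x
  proof -
    let ?y = "g (fst (f x) - 1, snd (f x))"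
    have y: "?y \<in> carrier S" "f ?y = (fst (f x) - 1, snd (f x))"
      using that range[of x] by (auto simp: l_def intro!: g)
    then have "x = \<sigma> ?y" using that by (intro eqI) (simp_all add: \<sigma>)
    then show ?thesis using y by blast
  qed
  moreover have "l (x \<otimes>\<^bsub>S\<^esub> y) = l x + l y + k" if "x \<in> carrier S" "y \<in> carrier S" for x y
    using that range[of x] range[of y] unfolding l_def hom[OF that] fst_conv by linarith
  moreover have "l (\<sigma> x) = Suc (l x)" if "x \<in> carrier S" for x
    using that range[of x] unfolding l_def \<sigma>(2)[OF that] fst_conv by linarith
  ultimately have "level_shift k S l \<sigma>" by (simp add: level_shift_def)
  then show ?thesis by (rule that)
qed

text \<open>
  Cancellation descends to a factor: pairs with a common first coordinate can only be separated
  in the second one.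
\<close>

lemma is_object_DirProd_sndD:
  assumes P: "is_object C (S \<times>\<times> W)"
  shows "is_object C W"
proof -
  have ne: "carrier S \<noteq> {}" "carrier W \<noteq> {}"
    using P by (auto simp: is_object_def is_semigroup_def)
  then obtain s where s: "s \<in> carrier S" by blast
  have "is_semigroup W"
    using P ne by (auto simp: is_object_def is_semigroup_def)
  moreover have "right_cancellative W" if "right_cancellative (S \<times>\<times> W)"
    using that s by (fastforce simp: right_cancellative_def)
  moreover have "left_cancellative W" if "left_cancellative (S \<times>\<times> W)"
    using that s by (fastforce simp: left_cancellative_def)
  moreover have "weakly_cancellative W" if w: "weakly_cancellative (S \<times>\<times> W)"
    unfolding weakly_cancellative_def
  proof (intro ballI impI)
    fix x y assume "x \<in> carrier W" "y \<in> carrier W" "x \<noteq> y"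
    then have "(s, x) \<in> carrier (S \<times>\<times> W)" "(s, y) \<in> carrier (S \<times>\<times> W)" "(s, x) \<noteq> (s, y)"
      using s by auto
    then obtain t where "t \<in> carrier (S \<times>\<times> W)"
      "(s, x) \<otimes>\<^bsub>S \<times>\<times> W\<^esub> t \<noteq> (s, y) \<otimes>\<^bsub>S \<times>\<times> W\<^esub> t \<or> t \<otimes>\<^bsub>S \<times>\<times> W\<^esub> (s, x) \<noteq> t \<otimes>\<^bsub>S \<times>\<times> W\<^esub> (s, y)"
      using w unfolding weakly_cancellative_def by blast
    then show "\<exists>t\<in>carrier W. x \<otimes>\<^bsub>W\<^esub> t \<noteq> y \<otimes>\<^bsub>W\<^esub> t \<or> t \<otimes>\<^bsub>W\<^esub> x \<noteq> t \<otimes>\<^bsub>W\<^esub> y"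
      by (cases t) auto
  qed
  ultimately show ?thesis
    using P by (cases C) (auto simp: is_object_def cancellative_def)
qed

text \<open>The closure of \<open>S\<close> is what makes the inverse of an isomorphism multiplicative.\<close>

lemma is_iso_sym:
  assumes S: "is_semigroup S" and iso: "S \<cong> T"
  shows "T \<cong> S"
proof -
  obtain f where f: "f \<in> iso S T" using iso by (auto simp: is_iso_def)
  have bij: "bij_betw f (carrier S) (carrier T)" using f by (simp add: iso_def)
  let ?g = "inv_into (carrier S) f"
  have g: "?g y \<in> carrier S" "f (?g y) = y" if "y \<in> carrier T" for y
    using bij that by (auto simp: bij_betw_def inv_into_into f_inv_into_f)
  have "?g (x \<otimes>\<^bsub>T\<^esub> y) = ?g x \<otimes>\<^bsub>S\<^esub> ?g y" if "x \<in> carrier T" "y \<in> carrier T" for x y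
  proof -
    have mem: "?g x \<otimes>\<^bsub>S\<^esub> ?g y \<in> carrier S" using S g that by (simp add: is_semigroup_def)
    have "f (?g x \<otimes>\<^bsub>S\<^esub> ?g y) = x \<otimes>\<^bsub>T\<^esub> y" using f g that by (simp add: iso_def hom_def)
    then show ?thesis using inv_into_f_f[OF bij_betw_imp_inj_on[OF bij] mem] by simp
  qed
  then have "?g \<in> iso T S"
    using g bij_betw_inv_into[OF bij] by (simp add: iso_def hom_def)
  then show ?thesis by (auto simp: is_iso_def)
qed

text \<open>
  Let \<open>r x\<close> be the element of level \<open>0\<close> of which \<open>x\<close> is an iterated shift. The complement of \<open>\<nat> + k\<close> is
  the set \<open>S0\<close> of elements of level \<open>0\<close>. A product of two of them has level \<open>k\<close>, so it has to be brought
  back to level \<open>0\<close> by \<open>r\<close> to define a multiplication on \<open>S0\<close>. That this is associative and inherits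
  the cancellation property comes for free from the isomorphism \<open>x \<mapsto> (l x + k, r x)\<close>.
\<close>

lemma level_shift_imp_admits_direct_factor:
  assumes S: "is_object C S" and ls: "level_shift k S l \<sigma>"
  shows "admits_direct_factor C S (nat_plus k)"
proof -
  have sg: "is_semigroup S" using S by (simp add: is_object_def)
  have cl: "x \<otimes>\<^bsub>S\<^esub> y \<in> carrier S" if "x \<in> carrier S" "y \<in> carrier S" for x y
    using sg that by (simp add: is_semigroup_def)
  have \<sigma>: "\<sigma> x \<in> carrier S" "l (\<sigma> x) = Suc (l x)" if "x \<in> carrier S" for x
    using ls that by (auto simp: level_shift_def central_shift_def)
  have \<sigma>_mult: "\<sigma> x \<otimes>\<^bsub>S\<^esub> y = \<sigma> (x \<otimes>\<^bsub>S\<^esub> y)" "x \<otimes>\<^bsub>S\<^esub> \<sigma> y = \<sigma> (x \<otimes>\<^bsub>S\<^esub> y)"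
    and l_mult: "l (x \<otimes>\<^bsub>S\<^esub> y) = l x + l y + k"
    if "x \<in> carrier S" "y \<in> carrier S" for x y
    using ls that by (auto simp: level_shift_def central_shift_def)
  have inj: "inj_on \<sigma> (carrier S)" using ls by (simp add: level_shift_def)
  have pow: "(\<sigma> ^^ n) x \<in> carrier S" "l ((\<sigma> ^^ n) x) = l x + n" if "x \<in> carrier S" for n x
    using that by (induction n) (simp_all add: \<sigma>)
  have pow_mult: "(\<sigma> ^^ m) x \<otimes>\<^bsub>S\<^esub> (\<sigma> ^^ n) y = (\<sigma> ^^ (m + n)) (x \<otimes>\<^bsub>S\<^esub> y)"
    if xy: "x \<in> carrier S" "y \<in> carrier S" for m n x y
  proof -
    have r: "x \<otimes>\<^bsub>S\<^esub> (\<sigma> ^^ n) y = (\<sigma> ^^ n) (x \<otimes>\<^bsub>S\<^esub> y)"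
      using xy by (induction n) (simp_all add: \<sigma>_mult pow)
    have "(\<sigma> ^^ m) x \<otimes>\<^bsub>S\<^esub> (\<sigma> ^^ n) y = (\<sigma> ^^ m) (x \<otimes>\<^bsub>S\<^esub> (\<sigma> ^^ n) y)"
      using xy by (induction m) (simp_all add: \<sigma>_mult pow)
    then show ?thesis by (simp add: r funpow_add)
  qed
  have pow_inj: "x = y" if "(\<sigma> ^^ n) x = (\<sigma> ^^ n) y" "x \<in> carrier S" "y \<in> carrier S" for n x y
    using that by (induction n) (auto dest: inj_onD[OF inj] simp: pow)
  define S0 where "S0 = {x \<in> carrier S. l x = 0}"
  have descend: "\<exists>y\<in>S0. x = (\<sigma> ^^ n) y" if "x \<in> carrier S" "l x = n" for n x
    using that
  proof (induction n arbitrary: x)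
    case 0
    then show ?case by (auto simp: S0_def)
  next
    case (Suc n)
    then obtain y where y: "y \<in> carrier S" "x = \<sigma> y"
      using ls by (auto simp: level_shift_def)
    with Suc.prems have "l y = n" by (simp add: \<sigma>)
    then obtain z where "z \<in> S0" "y = (\<sigma> ^^ n) z" using Suc.IH y by blast
    with y have "z \<in> S0" "x = (\<sigma> ^^ Suc n) z" by simp_all
    then show ?case by blast
  qed
  obtain r where r: "r x \<in> S0" "(\<sigma> ^^ l x) (r x) = x" if "x \<in> carrier S" for x
    using descend by metis
  have r_pow: "r ((\<sigma> ^^ n) y) = y" if "y \<in> S0" for n y
  proof -
    have c: "y \<in> carrier S" "l ((\<sigma> ^^ n) y) = n" using that by (auto simp: S0_def pow)
    then have "(\<sigma> ^^ n) (r ((\<sigma> ^^ n) y)) = (\<sigma> ^^ n) y" using r(2)[OF pow(1)] by metis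
    then show ?thesis using pow_inj c(1) r(1)[OF pow(1)] by (auto simp: S0_def)
  qed
  define W where "W = \<lparr>carrier = S0, mult = (\<lambda>x y. r (x \<otimes>\<^bsub>S\<^esub> y)), one = undefined\<rparr>"
  define f where "f x = (int (l x + k), r x)" for x
  have "f \<in> iso S (nat_plus k \<times>\<times> W)"
  proof -
    have "f (x \<otimes>\<^bsub>S\<^esub> y) = (int (l x + k) + int (l y + k), r (r x \<otimes>\<^bsub>S\<^esub> r y))"
      if xy: "x \<in> carrier S" "y \<in> carrier S" for x y
    proof -
      have c: "r x \<in> carrier S" "r y \<in> carrier S" "l (r x \<otimes>\<^bsub>S\<^esub> r y) = k"
        using r(1) xy by (auto simp: S0_def l_mult)
      have "x \<otimes>\<^bsub>S\<^esub> y = (\<sigma> ^^ (l x + l y)) (r x \<otimes>\<^bsub>S\<^esub> r y)"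
        using r(2) xy c by (simp flip: pow_mult)
      also have "\<dots> = (\<sigma> ^^ (l x + l y + k)) (r (r x \<otimes>\<^bsub>S\<^esub> r y))"
        using r(2)[OF cl[OF c(1,2)]] c(3) by (simp add: funpow_add)
      finally have "r (x \<otimes>\<^bsub>S\<^esub> y) = r (r x \<otimes>\<^bsub>S\<^esub> r y)"
        using r_pow r(1) cl c(1,2) by simp
      then show ?thesis using xy by (simp add: f_def l_mult)
    qed
    moreover have "f x \<in> {n. n \<ge> int k} \<times> S0" if "x \<in> carrier S" for x
      using r(1)[OF that] by (simp add: f_def)
    moreover have "inj_on f (carrier S)"
      by (rule inj_onI) (metis f_def r(2) Pair_inject add_right_cancel of_nat_eq_iff)
    moreover have "(n, y) \<in> f ` carrier S" if "n \<ge> int k" "y \<in> S0" for n y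
    proof -
      have "y \<in> carrier S" "l y = 0" using that by (auto simp: S0_def)
      then have "(n, y) = f ((\<sigma> ^^ nat (n - int k)) y)"
        using that by (simp add: f_def pow r_pow)
      then show ?thesis using pow(1) \<open>y \<in> carrier S\<close> by blast
    qed
    ultimately show ?thesis
      by (auto simp: iso_def hom_def bij_betw_def nat_plus_def W_def)
         (simp_all add: f_def)
  qed
  then have "is_object C W" "S \<cong> nat_plus k \<times>\<times> W"
    using is_object_DirProd_sndD[OF is_object_iso[OF S]] by (auto simp: is_iso_def)
  then show ?thesis by (auto simp: admits_direct_factor_def)
qed

section \<open>Primality\<close>

text \<open>
  Since \<open>\<beta>\<close> is onto, the second coordinate never obstructs writing a pair as a shift. Induction on the
  level therefore shows that the level of \<open>(a, b)\<close> does not depend on \<open>b\<close>, and freezing \<open>b\<close> at an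
  arbitrary \<open>b0\<close> gives the level on \<open>A\<close>.
\<close>

lemma level_shift_fst:
  assumes A: "is_semigroup A" and B: "is_semigroup B"
    and ls: "level_shift k (A \<times>\<times> B) l \<sigma>"
    and \<alpha>: "central_shift A \<alpha>"
    and split: "\<And>a b. a \<in> carrier A \<Longrightarrow> b \<in> carrier B \<Longrightarrow> \<sigma> (a, b) = (\<alpha> a, \<beta> b)"
    and surj: "\<beta> ` carrier B = carrier B"
  obtains l' where "level_shift k A l' \<alpha>"
proof -
  obtain b0 where b0: "b0 \<in> carrier B" using B by (auto simp: is_semigroup_def)
  have b0b0: "b0 \<otimes>\<^bsub>B\<^esub> b0 \<in> carrier B" using B b0 by (simp add: is_semigroup_def)
  have l_mult: "l (a \<otimes>\<^bsub>A\<^esub> a', b \<otimes>\<^bsub>B\<^esub> b') = l (a, b) + l (a', b') + k"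
    if "a \<in> carrier A" "a' \<in> carrier A" "b \<in> carrier B" "b' \<in> carrier B" for a a' b b'
    using ls that by (simp add: level_shift_def)
  have l_shift: "l (\<alpha> a, \<beta> b) = Suc (l (a, b))" if "a \<in> carrier A" "b \<in> carrier B" for a b
    using ls that by (simp add: level_shift_def flip: split)
  have preimage: "\<exists>a'\<in>carrier A. \<exists>b'\<in>carrier B. a = \<alpha> a' \<and> b = \<beta> b'"
    if "a \<in> carrier A" "b \<in> carrier B" "l (a, b) > 0" for a b
  proof -
    have "(a, b) \<in> \<sigma> ` (carrier A \<times> carrier B)" using ls that by (simp add: level_shift_def)
    then show ?thesis using split by auto
  qed
  \<comment> \<open>If \<open>(a, b) = \<sigma> (a1, b1)\<close> and \<open>b' = \<beta> b1'\<close>, then \<open>(a, b') = \<sigma> (a1, b1')\<close>, one level higher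
      than \<open>(a1, b1')\<close>.\<close>
  have indep: "l (a, b) = l (a, b')"
    if "a \<in> carrier A" "b \<in> carrier B" "b' \<in> carrier B" for a b b'
  proof -
    have "l (a, b) = n \<Longrightarrow> l (a, b') = n"
      if "a \<in> carrier A" "b \<in> carrier B" "b' \<in> carrier B" for n a b b'
      using that
    proof (induction n arbitrary: a b b')
      case 0
      show ?case
      proof (rule ccontr)
        assume "l (a, b') \<noteq> 0"
        then obtain a1 where "a1 \<in> carrier A" "a = \<alpha> a1" using preimage 0 by blast
        moreover obtain b1 where "b1 \<in> carrier B" "b = \<beta> b1" using surj 0 by blast
        ultimately show False using l_shift 0 by simp
      qed
    next
      case (Suc n)
      then obtain a1 b1 where 1: "a1 \<in> carrier A" "b1 \<in> carrier B" "a = \<alpha> a1" "b = \<beta> b1"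
        using preimage[of a b] by auto
      obtain b1' where 2: "b1' \<in> carrier B" "b' = \<beta> b1'" using surj Suc by blast
      have "l (a1, b1) = n" using Suc.prems 1 l_shift by simp
      then have "l (a1, b1') = n" using Suc.IH 1 2 by blast
      then show ?case using 1 2 l_shift by simp
    qed
    then show ?thesis using that by blast
  qed
  define l' where "l' a = l (a, b0)" for a
  have "inj_on \<alpha> (carrier A)"
  proof (rule inj_onI)
    fix a a' assume "a \<in> carrier A" "a' \<in> carrier A" "\<alpha> a = \<alpha> a'"
    moreover from this have "\<sigma> (a, b0) = \<sigma> (a', b0)" using b0 split by simp
    ultimately show "a = a'" using ls b0 by (auto simp: level_shift_def inj_on_def)
  qed
  moreover have "l' (a \<otimes>\<^bsub>A\<^esub> a') = l' a + l' a' + k" if "a \<in> carrier A" "a' \<in> carrier A" for a a'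
  proof -
    have "a \<otimes>\<^bsub>A\<^esub> a' \<in> carrier A" using A that by (simp add: is_semigroup_def)
    then show ?thesis
      using l_mult[OF that b0 b0] indep[OF _ b0 b0b0] by (simp add: l'_def)
  qed
  moreover have "l' (\<alpha> a) = Suc (l' a)" if a: "a \<in> carrier A" for a
  proof -
    have "\<alpha> a \<in> carrier A" using \<alpha> a by (simp add: central_shift_def)
    moreover have "\<beta> b0 \<in> carrier B" using surj b0 by blast
    ultimately show ?thesis
      using indep[of "\<alpha> a" b0 "\<beta> b0"] l_shift[OF a b0] b0 by (simp add: l'_def)
  qed
  moreover have "a \<in> \<alpha> ` carrier A" if "a \<in> carrier A" "l' a > 0" for a
    using preimage[OF that(1) b0] that(2) by (auto simp: l'_def)
  ultimately have "level_shift k A l' \<alpha>" using \<alpha> by (auto simp: level_shift_def)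
  then show ?thesis by (rule that)
qed

text \<open>
  If \<open>a\<close> and \<open>b\<close> were outside the images of \<open>\<alpha>\<close> and \<open>\<beta>\<close>, the element \<open>(a \<alpha>(a), \<beta>(b) b)\<close> would have two
  different levels: as \<open>(a, \<beta> b) (\<alpha> a, b)\<close> it is a product of elements of level \<open>0\<close>, whereas it also
  equals \<open>(a, b) \<sigma>(a, b)\<close>, a product of elements of levels \<open>0\<close> and \<open>1\<close>.
\<close>

lemma level_shift_surj:
  assumes ls: "level_shift k (A \<times>\<times> B) l \<sigma>"
    and \<alpha>: "central_shift A \<alpha>" and \<beta>: "central_shift B \<beta>"
    and split: "\<And>a b. a \<in> carrier A \<Longrightarrow> b \<in> carrier B \<Longrightarrow> \<sigma> (a, b) = (\<alpha> a, \<beta> b)"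
  shows "\<alpha> ` carrier A = carrier A \<or> \<beta> ` carrier B = carrier B"
proof (rule ccontr)
  assume "\<not> ?thesis"
  then obtain a b where a: "a \<in> carrier A" "a \<notin> \<alpha> ` carrier A"
      and b: "b \<in> carrier B" "b \<notin> \<beta> ` carrier B"
    using \<alpha> \<beta> by (auto simp: central_shift_def)
  have zero: "l (x, y) = 0"
    if "x \<in> carrier A" "y \<in> carrier B" "x \<notin> \<alpha> ` carrier A \<or> y \<notin> \<beta> ` carrier B" for x y
  proof (rule ccontr)
    assume "l (x, y) \<noteq> 0"
    then have "(x, y) \<in> \<sigma> ` (carrier A \<times> carrier B)" using ls that by (simp add: level_shift_def)
    then show False using that split by auto
  qed
  have \<alpha>a: "\<alpha> a \<in> carrier A" and \<beta>b: "\<beta> b \<in> carrier B"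
    using \<alpha> \<beta> a b by (auto simp: central_shift_def)
  have l_mult: "l (x \<otimes>\<^bsub>A\<^esub> x', y \<otimes>\<^bsub>B\<^esub> y') = l (x, y) + l (x', y') + k"
    if "x \<in> carrier A" "x' \<in> carrier A" "y \<in> carrier B" "y' \<in> carrier B" for x x' y y'
    using ls that by (simp add: level_shift_def)
  \<comment> \<open>\<open>a\<close> blocks the first factor \<open>(a, \<beta> b)\<close> from being a shift, \<open>b\<close> blocks the second one \<open>(\<alpha> a, b)\<close>.\<close>
  have "l (a \<otimes>\<^bsub>A\<^esub> \<alpha> a, \<beta> b \<otimes>\<^bsub>B\<^esub> b) = k"
    using l_mult[OF a(1) \<alpha>a \<beta>b b(1)] zero a b \<alpha>a \<beta>b by simp
  moreover have "(a \<otimes>\<^bsub>A\<^esub> \<alpha> a, \<beta> b \<otimes>\<^bsub>B\<^esub> b) = (a, b) \<otimes>\<^bsub>A \<times>\<times> B\<^esub> \<sigma> (a, b)"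
    using \<alpha> \<beta> a b by (simp add: split central_shift_def)
  moreover have "l ((a, b) \<otimes>\<^bsub>A \<times>\<times> B\<^esub> \<sigma> (a, b)) = l (a, b) + Suc (l (a, b)) + k"
    using ls a b \<alpha>a \<beta>b by (simp add: level_shift_def split)
  ultimately show False by simp
qed

lemma is_object_imp_weakly_cancellative:
  assumes S: "is_object C S"
  shows "is_object Weakly_Cancellative S"
proof -
  have "carrier S \<noteq> {}" using S by (simp add: is_object_def is_semigroup_def)
  then have "weakly_cancellative S" if "right_cancellative S \<or> left_cancellative S"
    using that unfolding right_cancellative_def left_cancellative_def weakly_cancellative_def
    by blast
  then show ?thesis using S by (cases C) (auto simp: is_object_def cancellative_def)
qed

lemma is_object_nat_plus: "is_object C (nat_plus k)"
  by (cases C) (auto simp: is_object_def is_semigroup_def cancellative_def right_cancellative_def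
      left_cancellative_def weakly_cancellative_def nat_plus_def)

lemma not_is_one_element_nat_plus: "\<not> is_one_element (nat_plus k)"
proof
  assume "is_one_element (nat_plus k)"
  then obtain e where "carrier (nat_plus k) = {e}" by (auto simp: is_one_element_def)
  moreover have "int k \<in> carrier (nat_plus k)" "int k + 1 \<in> carrier (nat_plus k)"
    by (simp_all add: nat_plus_def)
  ultimately show False by auto
qed

text \<open>
  All four categories are treated at once: weak cancellation, which the other three properties
  imply, splits the shift, and the complement inherits whichever property the category demands.
\<close>

lemma nat_plus_direct_factor_of_DirProd:
  assumes A: "is_object C A" and B: "is_object C B"
    and X: "admits_direct_factor C (A \<times>\<times> B) (nat_plus k)"
  shows "admits_direct_factor C A (nat_plus k) \<or> admits_direct_factor C B (nat_plus k)"
proof -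
  have sg: "is_semigroup A" "is_semigroup B" "is_semigroup (A \<times>\<times> B)"
    using A B is_object_DirProd[OF A B] by (simp_all add: is_object_def)
  obtain l \<sigma> where ls: "level_shift k (A \<times>\<times> B) l \<sigma>"
    using admits_direct_factor_imp_level_shift[OF sg(3) X] .
  then have "central_shift (A \<times>\<times> B) \<sigma>" by (simp add: level_shift_def)
  then obtain \<alpha> \<beta> where \<alpha>: "central_shift A \<alpha>" and \<beta>: "central_shift B \<beta>"
    and split: "\<And>a b. a \<in> carrier A \<Longrightarrow> b \<in> carrier B \<Longrightarrow> \<sigma> (a, b) = (\<alpha> a, \<beta> b)"
    using central_shift_DirProd_splits is_object_imp_weakly_cancellative A B by metis
  have "\<alpha> ` carrier A = carrier A \<or> \<beta> ` carrier B = carrier B"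
    using level_shift_surj[OF ls \<alpha> \<beta> split] .
  then show ?thesis
  proof
    assume surj: "\<beta> ` carrier B = carrier B"
    show ?thesis
      using level_shift_fst[OF sg(1,2) ls \<alpha> split surj]
        level_shift_imp_admits_direct_factor[OF A] by metis
  next
    assume surj: "\<alpha> ` carrier A = carrier A"
    show ?thesis
      using level_shift_fst[OF sg(2,1) level_shift_DirProd_swap[OF ls] \<beta> _ surj] split
        level_shift_imp_admits_direct_factor[OF B] by (metis comp_apply swap_simp)
  qed
qed

theorem theorem4p3:
  fixes k :: nat
  shows "prime_in Cancellative (nat_plus k) TYPE('y \<times> 'y0 \<times> 'y1) \<and>
         prime_in Right_Cancellative (nat_plus k) TYPE('y \<times> 'y0 \<times> 'y1) \<and>
         prime_in Left_Cancellative (nat_plus k) TYPE('y \<times> 'y0 \<times> 'y1) \<and>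
         prime_in Weakly_Cancellative (nat_plus k) TYPE('y \<times> 'y0 \<times> 'y1)"
proof -
  have "prime_in C (nat_plus k) TYPE('y \<times> 'y0 \<times> 'y1)" for C
    unfolding prime_in_def
  proof (intro conjI allI impI is_object_nat_plus not_is_one_element_nat_plus)
    fix Y :: "'y monoid" and A :: "'y0 monoid" and B :: "'y1 monoid"
    assume Y: "is_object C Y" and A: "is_object C A" and B: "is_object C B"
      and X: "admits_direct_factor C Y (nat_plus k)" and iso: "Y \<cong> A \<times>\<times> B"
    obtain Z :: "'y monoid" where Z: "is_object C Z" "Y \<cong> nat_plus k \<times>\<times> Z"
      using X by (auto simp: admits_direct_factor_def)
    \<comment> \<open>The complement \<open>Z\<close> lives on the type of \<open>Y\<close>; \<open>admits_direct_factorI\<close> moves it to that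
        of \<open>A \<times>\<times> B\<close>.\<close>
    have "A \<times>\<times> B \<cong> nat_plus k \<times>\<times> Z"
      using is_iso_sym[OF _ iso] Y Z(2) iso_trans by (auto simp: is_object_def)
    then show "admits_direct_factor C A (nat_plus k) \<or> admits_direct_factor C B (nat_plus k)"
      using nat_plus_direct_factor_of_DirProd[OF A B] admits_direct_factorI is_object_nat_plus Z(1)
      by blast
  qed
  then show ?thesis by blast
qed

end
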